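(* If a topological dynamical system has the specification property, then it has the vague specification property.
   Context: $\mathbb{N}_0=\{0,1,2,\ldots\}$, $\mathbb{N}=\{1,2,\ldots\}$. A topological dynamical system $(X,T)$ consists of a compact metrizable space $X$ and a continuous map $T\colon X\to X$. Fix a compatible metric $\rho$ on $X$ of diameter at most $1$ (the notions below do not depend on this choice). Specification property: for every $\varepsilon>0$ there is $M\in\mathbb{N}$ such that for every $k\in\mathbb{N}$, all points $x_1,\ldots,x_k\in X$ and all integers $0\le a_1\le b_1<a_2\le b_2<\cdots<a_k\le b_k$ with $a_i-b_{i-1}\ge M$ for $2\le i\le k$, there is $y\in X$ with $\rho(T^j(y),T^j(x_i))\le\varepsilon$ for all $1\le i\le k$ and $a_i\le j\le b_i$. For $A\subseteq\mathbb{N}_0$ we write $d(A)=1$ if $\lim_{n\to\infty}\frac{|A\cap[0,n)|}{n}=1$. $X^\infty$ is the set of all sequences $\underline{x}=\{x_n\}_{n=0}^\infty$ in $X$, with the product topology; $S(\underline{x})=\{x_{n+1}\}_{n=0}^\infty$ is the shift on $X^\infty$. Let $\Gamma_T=\{\{T^n(z)\}_{n=0}^\infty : z\in X\}\subseteq X^\infty$. Vague pseudo-orbit: $\underline{x}\in X^\infty$ such that for every open set $\mathcal{U}\subseteq X^\infty$ containing $\Gamma_T$ one has $d(\{n\in\mathbb{N}_0 : S^n(\underline{x})\in\mathcal{U}\})=1$. Vague specification property: for every vague pseudo-orbit $\underline{x}$ in $(X,T)$ there is $z\in X$ such that for every $\varepsilon>0$, $d(\{n\in\mathbb{N}_0 :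 \rho(T^n(z),x_n)<\varepsilon\})=1$. *)

theory Defs
  imports "HOL-Analysis.Analysis"
begin

definition topological_dynamical_system :: "'a topology \<Rightarrow> ('a \<Rightarrow> 'a) \<Rightarrow> bool" where
  "topological_dynamical_system X T \<longleftrightarrow>
     compact_space X \<and> metrizable_space X \<and> continuous_map X X T"

definition compatible_metric :: "'a topology \<Rightarrow> ('a \<Rightarrow> 'a \<Rightarrow> real) \<Rightarrow> bool" where
  "compatible_metric X \<rho> \<longleftrightarrow>
     Metric_space (topspace X) \<rho> \<and> Metric_space.mtopology (topspace X) \<rho> = X \<and>
     (\<forall>x\<in>topspace X. \<forall>y\<in>topspace X. \<rho> x y \<le> 1)"

definition specification_property ::
  "'a topology \<Rightarrow> ('a \<Rightarrow> 'a \<Rightarrow> real) \<Rightarrow> ('a \<Rightarrow> 'a) \<Rightarrow> bool" where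
  "specification_property X \<rho> T \<longleftrightarrow>
     (\<forall>\<epsilon>>0. \<exists>M\<ge>1. \<forall>k\<ge>1. \<forall>(x :: nat \<Rightarrow> 'a) (a :: nat \<Rightarrow> nat) (b :: nat \<Rightarrow> nat).
        (\<forall>i\<in>{1..k}. x i \<in> topspace X \<and> a i \<le> b i) \<longrightarrow>
        (\<forall>i\<in>{2..k}. b (i - 1) < a i \<and> b (i - 1) + M \<le> a i) \<longrightarrow>
        (\<exists>y\<in>topspace X. \<forall>i\<in>{1..k}. \<forall>j\<in>{a i..b i}. \<rho> ((T ^^ j) y) ((T ^^ j) (x i)) \<le> \<epsilon>))"

definition density_one :: "nat set \<Rightarrow> bool" where
  "density_one A \<longleftrightarrow> (\<lambda>n. real (card (A \<inter> {0..<n})) / real n) \<longlonglongrightarrow> 1"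

definition sequence_space :: "'a topology \<Rightarrow> (nat \<Rightarrow> 'a) topology" where
  "sequence_space X = product_topology (\<lambda>_. X) UNIV"

definition seq_shift :: "(nat \<Rightarrow> 'a) \<Rightarrow> nat \<Rightarrow> 'a" where
  "seq_shift x = (\<lambda>n. x (n + 1))"

definition orbit_sequences :: "'a topology \<Rightarrow> ('a \<Rightarrow> 'a) \<Rightarrow> (nat \<Rightarrow> 'a) set" where
  "orbit_sequences X T = {(\<lambda>n. (T ^^ n) z) | z. z \<in> topspace X}"

definition vague_pseudo_orbit :: "'a topology \<Rightarrow> ('a \<Rightarrow> 'a) \<Rightarrow> (nat \<Rightarrow> 'a) \<Rightarrow> bool" where
  "vague_pseudo_orbit X T x \<longleftrightarrow>
     x \<in> topspace (sequence_space X) \<and>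
     (\<forall>U. openin (sequence_space X) U \<and> orbit_sequences X T \<subseteq> U \<longrightarrow>
        density_one {n. (seq_shift ^^ n) x \<in> U})"

definition vague_specification_property ::
  "'a topology \<Rightarrow> ('a \<Rightarrow> 'a \<Rightarrow> real) \<Rightarrow> ('a \<Rightarrow> 'a) \<Rightarrow> bool" where
  "vague_specification_property X \<rho> T \<longleftrightarrow>
     (\<forall>x. vague_pseudo_orbit X T x \<longrightarrow>
        (\<exists>z\<in>topspace X. \<forall>\<epsilon>>0. density_one {n. \<rho> ((T ^^ n) z) (x n) < \<epsilon>}))"

end

(*
  Cut time into blocks of length L much larger than the gap M that specification needs for a
  precision e. For a vague pseudo-orbit x, all but a small proportion of the blocks of x are e-close
  to true orbit segments, and specification traces all of these while also following, with
  error e, any given orbit up to the start of the blocks. Use precision 2^-k on the k-th of a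
  sequence of rapidly growing time intervals: z_(k+1) follows z_k on the earlier intervals and
  traces x on the k-th. The errors are summable, so a limit point z of (z_k) traces x
  with error 3 * 2^-k on the k-th interval, outside the gaps and the bad blocks; these have
  density zero because the intervals grow fast enough.
*)
theory Submission
  imports Defs "HOL-Real_Asymp.Real_Asymp"
begin

section \<open>Density of sets of times\<close>

text \<open>Counting the complement gives bounds free of division, which later counts add up by
  linear arithmetic.\<close>

lemma density_one_iff_complement:
  "density_one A \<longleftrightarrow>
     (\<forall>e>0. \<forall>\<^sub>F n in sequentially. real (card ({0..<n} - A)) \<le> e * real n)"
proof -
  have eq: "\<bar>real (card (A \<inter> {0..<n})) / real n - 1\<bar> = real (card ({0..<n} - A)) / real n"
    if "n \<ge> 1" for n
  proof -
    have "card ({0..<n} - A) + card (A \<inter> {0..<n}) = n"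
      using card_Diff_subset_Int[of "{0..<n}" A] card_mono[of "{0..<n}" "A \<inter> {0..<n}"]
      by (simp add: Int_commute)
    then have "real (card ({0..<n} - A)) + real (card (A \<inter> {0..<n})) = real n"
      by (metis of_nat_add)
    then have "real (card (A \<inter> {0..<n})) = real n - real (card ({0..<n} - A))" by simp
    then have "real (card (A \<inter> {0..<n})) / real n - 1 = - (real (card ({0..<n} - A)) / real n)"
      using that by (simp add: diff_divide_distrib)
    then show ?thesis by simp
  qed
  have "density_one A \<longleftrightarrow>
      (\<forall>e>0. \<forall>\<^sub>F n in sequentially. real (card ({0..<n} - A)) / real n < e)"
    unfolding density_one_def tendsto_iff dist_real_def
    by (intro all_cong1 imp_cong refl eventually_cong[OF eventually_ge_at_top[of 1]])
      (simp add: eq)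
  also have "\<dots> \<longleftrightarrow> (\<forall>e>0. \<forall>\<^sub>F n in sequentially. real (card ({0..<n} - A)) \<le> e * real n)"
  proof (intro iffI allI impI)
    fix e :: real
    assume "\<forall>e>0. \<forall>\<^sub>F n in sequentially. real (card ({0..<n} - A)) / real n < e" "e > 0"
    then have "\<forall>\<^sub>F n in sequentially. real (card ({0..<n} - A)) / real n < e" by blast
    then show "\<forall>\<^sub>F n in sequentially. real (card ({0..<n} - A)) \<le> e * real n"
      using eventually_ge_at_top[of 1] by eventually_elim (simp add: field_simps)
  next
    fix e :: real
    assume "\<forall>e>0. \<forall>\<^sub>F n in sequentially. real (card ({0..<n} - A)) \<le> e * real n" "e > 0"
    then have "\<forall>\<^sub>F n in sequentially. real (card ({0..<n} - A)) \<le> e / 2 * real n"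
      using half_gt_zero by blast
    then show "\<forall>\<^sub>F n in sequentially. real (card ({0..<n} - A)) / real n < e"
      using eventually_ge_at_top[of 1]
    proof eventually_elim
      case (elim n)
      then have "real (card ({0..<n} - A)) / real n \<le> e / 2" by (simp add: field_simps)
      also have "\<dots> < e" using \<open>e > 0\<close> by simp
      finally show ?case .
    qed
  qed
  finally show ?thesis .
qed

text \<open>Below \<open>n\<close>, a time missing from \<open>G\<close> is either less than
  \<open>m\<close> or the shift by \<open>m\<close> of a time missing from \<open>D\<close>; the
  constant \<open>m\<close> is negligible against \<open>n\<close>.\<close>

lemma density_one_translate:
  assumes "density_one D" and "\<And>n. n \<in> D \<Longrightarrow> n + m \<in> G"
  shows "density_one G"
  unfolding density_one_iff_complement
proof (intro allI impI)
  fix e :: real assume "e > 0"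
  then have "\<forall>\<^sub>F n in sequentially. real (card ({0..<n} - D)) \<le> e / 2 * real n"
    using assms(1) half_gt_zero unfolding density_one_iff_complement by blast
  moreover have "\<forall>\<^sub>F n in sequentially. real m \<le> e / 2 * real n"
    using \<open>e > 0\<close> by real_asymp
  ultimately show "\<forall>\<^sub>F n in sequentially. real (card ({0..<n} - G)) \<le> e * real n"
  proof eventually_elim
    case (elim n)
    have "{0..<n} - G \<subseteq> {0..<m} \<union> (\<lambda>i. i + m) ` ({0..<n} - D)"
    proof
      fix i assume i: "i \<in> {0..<n} - G"
      show "i \<in> {0..<m} \<union> (\<lambda>i. i + m) ` ({0..<n} - D)"
      proof (cases "i < m")
        case False
        then have "i = (i - m) + m" "i - m \<in> {0..<n} - D"
          using i assms(2)[of "i - m"] by auto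
        then show ?thesis by blast
      qed simp
    qed
    then have "card ({0..<n} - G) \<le> card ({0..<m} \<union> (\<lambda>i. i + m) ` ({0..<n} - D))"
      by (intro card_mono) auto
    also have "\<dots> \<le> card {0..<m} + card ((\<lambda>i. i + m) ` ({0..<n} - D))"
      by (rule card_Un_le)
    also have "\<dots> \<le> m + card ({0..<n} - D)"
      using card_image_le[of "{0..<n} - D" "\<lambda>i. i + m"] by simp
    finally show ?case using elim by linarith
  qed
qed

lemma strict_mono_interval:
  fixes N :: "nat \<Rightarrow> nat"
  assumes "strict_mono N" "N 0 \<le> n"
  obtains k where "N k \<le> n" "n < N (Suc k)"
proof -
  define p where "p = (LEAST p. n < N p)"
  have "n < N (Suc n)"
    using strict_mono_imp_increasing[OF assms(1), of "Suc n"] by simp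
  then have p: "n < N p" unfolding p_def by (rule LeastI)
  then obtain k where k: "p = Suc k"
    using assms(2) by (cases p) auto
  have "\<not> n < N k"
    using not_less_Least[of k "\<lambda>p. n < N p"] k unfolding p_def by simp
  then show thesis using that[of k] p k by simp
qed

text \<open>If \<open>n\<close> lies in interval \<open>k + 1\<close>, the times before
  \<open>N k\<close> are few by the growth of \<open>N\<close>, and the last two intervals are
  covered by \<open>C k\<close> and \<open>C (Suc k)\<close>, counted up to \<open>N (Suc k)\<close>
  and \<open>n\<close>, where their bounds already hold. Each of the three shares is at most
  \<open>e / 3 * n\<close>.\<close>

lemma patched_density_zero:
  fixes N :: "nat \<Rightarrow> nat" and \<delta> :: "nat \<Rightarrow> real"
  assumes N: "strict_mono N" "\<And>k. Suc k * N k \<le> N (Suc k)"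
    and C: "\<And>k n. N k \<le> n \<Longrightarrow> real (card (C k \<inter> {0..<n})) \<le> \<delta> k * real n"
    and \<delta>: "\<delta> \<longlonglongrightarrow> 0"
    and B: "\<And>k. B \<inter> {N k..<N (Suc k)} \<subseteq> C k"
    and "e > 0"
  shows "\<forall>\<^sub>F n in sequentially. real (card (B \<inter> {0..<n})) \<le> e * real n"
proof -
  have "\<forall>\<^sub>F k in sequentially. \<delta> k < e / 3"
    using \<open>e > 0\<close> by (intro order_tendstoD(2)[OF \<delta>]) simp
  moreover have "\<forall>\<^sub>F k in sequentially. 1 / real (Suc k) < e / 3"
    using \<open>e > 0\<close> by real_asymp
  ultimately have "\<forall>\<^sub>F k in sequentially. \<delta> k < e / 3 \<and> 1 / real (Suc k) < e / 3"
    by eventually_elim simp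
  then obtain K where K: "\<And>k. k \<ge> K \<Longrightarrow> \<delta> k < e / 3 \<and> 1 / real (Suc k) < e / 3"
    unfolding eventually_sequentially by blast
  have "real (card (B \<inter> {0..<n})) \<le> e * real n" if n: "n \<ge> N (Suc K)" for n
  proof -
    have mono: "i \<le> j \<Longrightarrow> N i \<le> N j" for i j
      using N(1) by (simp add: strict_mono_less_eq)
    obtain k' where k': "N k' \<le> n" "n < N (Suc k')"
      using strict_mono_interval[OF N(1) order.trans[OF mono[OF le0] n]] .
    \<comment> \<open>As \<open>n\<close> is at least \<open>N (Suc K)\<close>, its interval has a
      predecessor with index \<open>k \<ge> K\<close>, so the choice of \<open>K\<close> applies to
      both.\<close>
    have "Suc K < Suc k'"
      using n k'(2) mono[of "Suc k'" "Suc K"] by (meson leD le_less_linear order.trans)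
    then obtain k where k: "k' = Suc k" "k \<ge> K"
      by (cases k') auto
    let ?a = "N k" and ?b = "N (Suc k)"
    have "B \<inter> {0..<n} \<subseteq> {0..<?a} \<union> (C k \<inter> {0..<?b} \<union> C (Suc k) \<inter> {0..<n})"
      using B[of k] B[of "Suc k"] k k' by force
    then have "card (B \<inter> {0..<n}) \<le> card ({0..<?a} \<union> (C k \<inter> {0..<?b} \<union> C (Suc k) \<inter> {0..<n}))"
      by (intro card_mono) auto
    also have "\<dots> \<le> card {0..<?a} + (card (C k \<inter> {0..<?b}) + card (C (Suc k) \<inter> {0..<n}))"
      by (meson card_Un_le le_trans nat_add_left_cancel_le)
    finally have "real (card (B \<inter> {0..<n}))
        \<le> real ?a + (real (card (C k \<inter> {0..<?b})) + real (card (C (Suc k) \<inter> {0..<n})))"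
      by (simp flip: of_nat_add)
    moreover have "real ?a \<le> e / 3 * real n"
    proof -
      have "real (Suc k) * real ?a \<le> real ?b" using N(2)[of k] by (simp only: of_nat_mult[symmetric] of_nat_le_iff)
      then have "real ?a \<le> 1 / real (Suc k) * real ?b" by (simp add: field_simps)
      also have "\<dots> \<le> e / 3 * real n"
        using K[OF k(2)] k k' \<open>e > 0\<close> by (intro mult_mono) auto
      finally show ?thesis .
    qed
    moreover have "real (card (C k \<inter> {0..<?b})) \<le> e / 3 * real n"
    proof -
      have "real (card (C k \<inter> {0..<?b})) \<le> \<delta> k * real ?b"
        by (intro C mono) simp
      also have "\<dots> \<le> e / 3 * real ?b"
        using K[OF k(2)] by (intro mult_right_mono) auto
      also have "\<dots> \<le> e / 3 * real n"
        using k k' \<open>e > 0\<close> by (intro mult_left_mono) auto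
      finally show ?thesis .
    qed
    moreover have "real (card (C (Suc k) \<inter> {0..<n})) \<le> e / 3 * real n"
    proof -
      have "real (card (C (Suc k) \<inter> {0..<n})) \<le> \<delta> (Suc k) * real n"
        using k k' by (intro C) simp
      also have "\<dots> \<le> e / 3 * real n"
        using K[of "Suc k"] k(2) by (intro mult_right_mono) auto
      finally show ?thesis .
    qed
    ultimately show ?thesis by linarith
  qed
  then show ?thesis unfolding eventually_sequentially by blast
qed

text \<open>The gaps, the first \<open>M\<close> times of each block, form a proportion
  \<open>M / L \<le> e\<close>. A start outside \<open>G\<close> costs a whole block of
  \<open>L\<close> times, so these starts are counted with precision \<open>e / L\<close>. The third
  \<open>e\<close> absorbs the gap of the last, possibly incomplete block.\<close>

lemma blockwise_density:
  fixes G :: "nat set"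
  assumes G: "density_one G" and L: "L > 0" "real M \<le> e * real L" and "e > 0"
  shows "\<forall>\<^sub>F n in sequentially.
    real (card ({n. n mod L < M \<or> L * (n div L) \<notin> G} \<inter> {0..<n})) \<le> 3 * e * real n"
proof -
  have "e / real L > 0" using assms by simp
  then have "\<forall>\<^sub>F n in sequentially. real (card ({0..<n} - G)) \<le> e / real L * real n"
    using G unfolding density_one_iff_complement by blast
  moreover have "\<forall>\<^sub>F n in sequentially. real M \<le> e * real n"
    using \<open>e > 0\<close> by real_asymp
  ultimately show ?thesis
  proof eventually_elim
    case (elim n)
    let ?C = "{n. n mod L < M \<or> L * (n div L) \<notin> G} \<inter> {0..<n}"
    let ?f = "\<lambda>(p, r). p * L + r" and ?g = "\<lambda>(p, r). p + r"
    let ?P = "{..n div L} \<times> {..<M}" and ?Q = "({0..<n} - G) \<times> {..<L}"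
    have "?C \<subseteq> ?f ` ?P \<union> ?g ` ?Q"
    proof
      fix i assume i: "i \<in> ?C"
      show "i \<in> ?f ` ?P \<union> ?g ` ?Q"
      proof (cases "i mod L < M")
        case True
        then have "(i div L, i mod L) \<in> ?P" using i by (auto simp: div_le_mono)
        moreover have "i = ?f (i div L, i mod L)" by simp
        ultimately show ?thesis by blast
      next
        case False
        have "L * (i div L) < n"
          using i by (intro le_less_trans[OF times_div_less_eq_dividend]) simp
        then have "(L * (i div L), i mod L) \<in> ?Q" using i False L by auto
        moreover have "i = ?g (L * (i div L), i mod L)" by simp
        ultimately show ?thesis by blast
      qed
    qed
    then have "card ?C \<le> card (?f ` ?P \<union> ?g ` ?Q)" by (intro card_mono) auto
    also have "\<dots> \<le> card (?f ` ?P) + card (?g ` ?Q)" by (rule card_Un_le)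
    also have "\<dots> \<le> card ?P + card ?Q" by (intro add_mono card_image_le) auto
    also have "\<dots> = Suc (n div L) * M + card ({0..<n} - G) * L"
      by (simp add: card_cartesian_product)
    finally have "real (card ?C) \<le> real (Suc (n div L) * M + card ({0..<n} - G) * L)"
      by (simp only: of_nat_le_iff)
    then have "real (card ?C)
        \<le> real (n div L) * real M + real M + real (card ({0..<n} - G)) * real L"
      by (simp add: algebra_simps)
    moreover have "real (n div L) * real M \<le> e * real n"
    proof -
      have "real (n div L) * real M \<le> real (n div L) * (e * real L)"
        using L by (intro mult_left_mono) auto
      also have "\<dots> = e * real (n div L * L)" by simp
      also have "\<dots> \<le> e * real n" using \<open>e > 0\<close>
        by (intro mult_left_mono) (simp_all only: of_nat_le_iff, simp_all)
      finally show ?thesis .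
    qed
    moreover have "real (card ({0..<n} - G)) * real L \<le> e * real n"
      using elim(1) L by (simp add: field_simps)
    ultimately show ?case using elim(2) by linarith
  qed
qed

section \<open>Iterates, shifts and compactness\<close>

lemma continuous_map_funpow:
  assumes "continuous_map X X T"
  shows "continuous_map X X (T ^^ n)"
proof (induction n)
  case (Suc n)
  then show ?case using assms unfolding funpow.simps by (rule continuous_map_compose)
qed (simp add: id_def)

lemma funpow_seq_shift: "(seq_shift ^^ n) x j = x (n + j)"
  by (induction n arbitrary: j) (auto simp: seq_shift_def)

text \<open>The images minus \<open>W\<close> are closed and decreasing; were all of them nonempty,
  compactness would give a common point, lying in every image but outside \<open>W\<close>.\<close>

lemma iterated_image_in_neighbourhood:
  assumes "compact_space X" "Hausdorff_space X" "continuous_map X X T"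
    and W: "openin X W" "(\<Inter>n. (T ^^ n) ` topspace X) \<subseteq> W"
  shows "\<exists>m. (T ^^ m) ` topspace X \<subseteq> W"
proof (rule ccontr)
  assume contra: "\<not> ?thesis"
  have sub: "(T ^^ n) ` topspace X \<subseteq> topspace X" for n
    using continuous_map_funpow[OF assms(3)] by (rule continuous_map_image_subset_topspace)
  define C where "C n = (T ^^ n) ` topspace X - W" for n
  have "closedin X (C n)" for n
    unfolding C_def
    using assms continuous_map_funpow[OF assms(3), of n]
    by (intro closedin_diff compactin_imp_closedin image_compactin[of X])
      (auto simp: compact_space_def)
  moreover have "C n \<noteq> {}" for n
    using contra by (auto simp: C_def)
  moreover have "decseq C"
    unfolding decseq_Suc_iff C_def using sub[of 1]
    by (auto simp: funpow_swap1)
  ultimately have "(\<Inter>n. C n) \<noteq> {}"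
    by (rule compact_space_imp_nest[OF assms(1)])
  then show False using W(2) by (auto simp: C_def)
qed

section \<open>Vague pseudo-orbits and the core of the system\<close>

context Metric_space
begin

text \<open>A finite intersection of preimages of balls. General maps \<open>f j\<close> make it
  serve both in the phase space, with the iterates of \<open>T\<close>, and in the sequence space,
  with the coordinate projections.\<close>

lemma openin_finitely_many_near:
  fixes f :: "nat \<Rightarrow> 'b \<Rightarrow> 'a"
  assumes f: "\<And>j. continuous_map Z mtopology (f j)" and s: "\<And>j. s j \<in> M"
  shows "openin Z {u \<in> topspace Z. \<forall>j<L. d (f j u) (s j) < e}"
proof (induction L)
  case (Suc L)
  have "openin Z {u \<in> topspace Z. f L u \<in> mball (s L) e}"
    by (intro openin_continuous_map_preimage[OF f]) simp
  then have "openin Z ({u \<in> topspace Z. \<forall>j<L. d (f j u) (s j) < e} \<inter>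
      {u \<in> topspace Z. f L u \<in> mball (s L) e})"
    using Suc by blast
  also have "{u \<in> topspace Z. \<forall>j<L. d (f j u) (s j) < e} \<inter> {u \<in> topspace Z. f L u \<in> mball (s L) e}
      = {u \<in> topspace Z. \<forall>j<Suc L. d (f j u) (s j) < e}"
    using s continuous_map_image_subset_topspace[OF f, of L]
    by (auto simp: commute less_Suc_eq image_subset_iff)
  finally show ?case .
qed simp

text \<open>Specification only traces an orbit segment starting at time \<open>n\<close> if its initial point lies
  in \<open>T\<^sup>n X\<close>. As \<open>T\<close> need not be surjective, the segments of the pseudo-orbit have to be compared
  with orbits in \<open>\<Inter>\<^sub>n T\<^sup>n X\<close>.\<close>
lemma vague_pseudo_orbit_near_core:
  assumes compact: "compact_space mtopology" and T: "continuous_map mtopology mtopology T"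
    and x: "vague_pseudo_orbit mtopology T x" and "e > 0"
  shows "density_one {n. \<exists>y\<in>(\<Inter>n. (T ^^ n) ` M). \<forall>j<L. d (x (n + j)) ((T ^^ j) y) < e}"
proof -
  have Tn: "continuous_map mtopology mtopology (T ^^ n)" for n
    by (rule continuous_map_funpow[OF T])
  have TM: "(T ^^ n) u \<in> M" if "u \<in> M" for n u
    using continuous_map_image_subset_topspace[OF Tn[of n]] that by auto
  define Y where "Y = (\<Inter>n. (T ^^ n) ` M)"
  have "Y \<subseteq> (T ^^ 0) ` M" unfolding Y_def by blast
  then have YM: "Y \<subseteq> M" by simp
  have xM: "x n \<in> M" for n
    using x by (auto simp: vague_pseudo_orbit_def sequence_space_def PiE_iff)
  \<comment> \<open>\<open>?W\<close> is an open neighbourhood of the core \<open>Y\<close>, so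
    compactness yields an \<open>m\<close> after which every orbit is close to a core orbit for
    \<open>L\<close> steps.\<close>
  let ?W = "\<Union>y\<in>Y. {u \<in> topspace mtopology. \<forall>j<L. d ((T ^^ j) u) ((T ^^ j) y) < e / 2}"
  have "openin mtopology ?W"
    using YM TM by (intro openin_Union) (auto intro!: openin_finitely_many_near Tn
        simp del: topspace_mtopology less_divide_eq_numeral1)
  moreover have "(\<Inter>n. (T ^^ n) ` topspace mtopology) \<subseteq> ?W"
    unfolding topspace_mtopology Y_def[symmetric]
  proof
    fix y assume y: "y \<in> Y"
    then have "d ((T ^^ j) y) ((T ^^ j) y) < e / 2" for j
      using YM TM \<open>e > 0\<close> by (simp add: subset_iff)
    then show "y \<in> (\<Union>y\<in>Y. {u \<in> M. \<forall>j<L. d ((T ^^ j) u) ((T ^^ j) y) < e / 2})"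
      using y YM by blast
  qed
  ultimately have "\<exists>m. (T ^^ m) ` topspace mtopology \<subseteq> ?W"
    by (rule iterated_image_in_neighbourhood[OF compact Hausdorff_space_mtopology T])
  then obtain m where "(T ^^ m) ` topspace mtopology \<subseteq> ?W" ..
  then have m: "\<exists>y\<in>Y. \<forall>j<L. d ((T ^^ j) ((T ^^ m) z)) ((T ^^ j) y) < e / 2" if "z \<in> M" for z
    using that by fastforce
  let ?S = "sequence_space mtopology"
  \<comment> \<open>The window has length \<open>L + m\<close>: its first \<open>m\<close> terms are
    given up to let the shadowing orbit come near the core. The precision \<open>e / 2\<close> is
    spent once here and once in \<open>?W\<close>.\<close>
  let ?U = "\<Union>z\<in>M. {s \<in> topspace ?S. \<forall>j<L + m. d (s j) ((T ^^ j) z) < e / 2}"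
  have "openin ?S ?U"
    using TM unfolding sequence_space_def
    by (intro openin_Union)
      (auto intro!: openin_finitely_many_near continuous_map_product_projection
        simp del: topspace_product_topology less_divide_eq_numeral1)
  moreover have "orbit_sequences mtopology T \<subseteq> ?U"
  proof
    fix s assume "s \<in> orbit_sequences mtopology T"
    then obtain z where z: "z \<in> M" "s = (\<lambda>n. (T ^^ n) z)"
      by (auto simp: orbit_sequences_def)
    then have "s \<in> topspace ?S" "\<And>j. d (s j) ((T ^^ j) z) < e / 2"
      using TM \<open>e > 0\<close> by (auto simp: sequence_space_def)
    then show "s \<in> ?U" using z(1) by blast
  qed
  ultimately have "density_one {n. (seq_shift ^^ n) x \<in> ?U}"
    using x unfolding vague_pseudo_orbit_def by blast
  then show ?thesis
    unfolding Y_def[symmetric]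
  proof (rule density_one_translate[where m = m])
    fix n assume "n \<in> {n. (seq_shift ^^ n) x \<in> ?U}"
    then obtain z where z: "z \<in> M" "\<And>j. j < L + m \<Longrightarrow> d (x (n + j)) ((T ^^ j) z) < e / 2"
      by (auto simp: funpow_seq_shift)
    obtain y where y: "y \<in> Y" "\<And>j. j < L \<Longrightarrow> d ((T ^^ j) ((T ^^ m) z)) ((T ^^ j) y) < e / 2"
      using m[OF z(1)] by blast
    have "d (x (n + m + j)) ((T ^^ j) y) < e" if "j < L" for j
    proof -
      have "d (x (n + m + j)) ((T ^^ (m + j)) z) < e / 2"
        using z(2)[of "m + j"] that by (simp add: add.assoc)
      moreover have "d ((T ^^ (m + j)) z) ((T ^^ j) y) < e / 2"
        using y(2)[OF that] by (metis add.commute comp_apply funpow_add)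
      moreover have "d (x (n + m + j)) ((T ^^ j) y)
          \<le> d (x (n + m + j)) ((T ^^ (m + j)) z) + d ((T ^^ (m + j)) z) ((T ^^ j) y)"
        using z(1) y(1) YM TM xM by (intro triangle) auto
      ultimately show ?thesis by linarith
    qed
    then show "n + m \<in> {n. \<exists>y\<in>Y. \<forall>j<L. d (x (n + j)) ((T ^^ j) y) < e}"
      using y(1) by blast
  qed
qed

section \<open>Extending an orbit by specification\<close>

text \<open>The exceptional set \<open>C\<close> and the block length \<open>L\<close> do not depend on the orbit \<open>w\<close>, nor on the
  times \<open>q * L\<close> and \<open>N\<close>; this lets the main induction choose all its time intervals before the
  points.\<close>
lemma specification_extend:
  assumes compact: "compact_space mtopology" and T: "continuous_map mtopology mtopology T"
    and spec: "specification_property mtopology d T"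
    and x: "vague_pseudo_orbit mtopology T x" and "e > 0"
  obtains L C where "L > 0"
    and "\<forall>\<^sub>F n in sequentially. real (card (C \<inter> {0..<n})) \<le> 3 * e * real n"
    and "\<And>w q N. w \<in> M \<Longrightarrow> q > 0 \<Longrightarrow>
      \<exists>y\<in>M. (\<forall>j<q * L. d ((T ^^ j) y) ((T ^^ j) w) \<le> e) \<and>
        (\<forall>j\<in>{q * L..<N} - C. d ((T ^^ j) y) (x j) \<le> 2 * e)"
proof -
  have TM: "(T ^^ n) u \<in> M" if "u \<in> M" for n u
    using continuous_map_image_subset_topspace[OF continuous_map_funpow[OF T, of n]] that by auto
  have xM: "x n \<in> M" for n
    using x by (auto simp: vague_pseudo_orbit_def sequence_space_def PiE_iff)
  obtain M0 where M0: "M0 \<ge> 1" and trace: "\<And>k (p :: nat \<Rightarrow> 'a) (a :: nat \<Rightarrow> nat) (b :: nat \<Rightarrow> nat).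
      \<lbrakk>k \<ge> 1; \<forall>i\<in>{1..k}. p i \<in> M \<and> a i \<le> b i;
        \<forall>i\<in>{2..k}. b (i - 1) < a i \<and> b (i - 1) + M0 \<le> a i\<rbrakk> \<Longrightarrow>
      \<exists>y\<in>M. \<forall>i\<in>{1..k}. \<forall>j\<in>{a i..b i}. d ((T ^^ j) y) ((T ^^ j) (p i)) \<le> e"
    using spec \<open>e > 0\<close> unfolding specification_property_def topspace_mtopology by metis
  \<comment> \<open>A block longer than \<open>M0\<close> keeps a nonempty segment after its gap;
    the ratio makes the gaps a proportion of at most \<open>e\<close>.\<close>
  obtain L where L: "L > M0" "real M0 \<le> e * real L"
  proof -
    have "\<forall>\<^sub>F n in sequentially. real M0 \<le> e * real n"
      using \<open>e > 0\<close> by real_asymp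
    then have "\<forall>\<^sub>F n in sequentially. n > M0 \<and> real M0 \<le> e * real n"
      using eventually_gt_at_top[of M0] by eventually_elim simp
    then show thesis using that unfolding eventually_sequentially by blast
  qed
  define Y where "Y = (\<Inter>n. (T ^^ n) ` M)"
  define G where "G = {n. \<exists>y\<in>Y. \<forall>j<L. d (x (n + j)) ((T ^^ j) y) < e}"
  define C where "C = {n. n mod L < M0 \<or> L * (n div L) \<notin> G}"
  have "density_one G"
    unfolding G_def Y_def by (rule vague_pseudo_orbit_near_core[OF compact T x \<open>e > 0\<close>])
  then have C_small: "\<forall>\<^sub>F n in sequentially. real (card (C \<inter> {0..<n})) \<le> 3 * e * real n"
    unfolding C_def using L \<open>e > 0\<close> by (intro blockwise_density) auto
  \<comment> \<open>A core point \<open>y\<close> has an \<open>n\<close>-th preimage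
    \<open>u\<close>, whose orbit is at \<open>y\<close> at time \<open>n\<close>, as specification
    needs. For \<open>n\<close> outside \<open>G\<close> any point will do, since a block starting
    there lies in \<open>C\<close>.\<close>
  have "\<exists>u\<in>M. n \<in> G \<longrightarrow> (\<forall>j<L. d (x (n + j)) ((T ^^ (n + j)) u) < e)" for n
  proof (cases "n \<in> G")
    case True
    then obtain y where y: "y \<in> Y" "\<forall>j<L. d (x (n + j)) ((T ^^ j) y) < e"
      by (auto simp: G_def)
    then obtain u where u: "u \<in> M" "y = (T ^^ n) u" unfolding Y_def by blast
    have "(T ^^ (n + j)) u = (T ^^ j) y" for j
      by (simp add: u(2) add.commute[of n] funpow_add)
    then show ?thesis using y(2) u(1) by (intro bexI[of _ u]) simp_all
  qed (use xM in blast)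
  then obtain u where u: "\<And>n. u n \<in> M"
      "\<And>n j. n \<in> G \<Longrightarrow> j < L \<Longrightarrow> d (x (n + j)) ((T ^^ (n + j)) (u n)) < e"
    by metis
  have "\<exists>y\<in>M. (\<forall>j<q * L. d ((T ^^ j) y) ((T ^^ j) w) \<le> e) \<and>
      (\<forall>j\<in>{q * L..<N} - C. d ((T ^^ j) y) (x j) \<le> 2 * e)" if w: "w \<in> M" and q: "q > 0" for w q N
  proof -
    \<comment> \<open>Segment 1 is the orbit of \<open>w\<close> on the first \<open>q\<close>
      blocks; segment \<open>i \<ge> 2\<close> is block \<open>q + i - 2\<close> without its first
      \<open>M0\<close> times. The count \<open>N + 1\<close> generously reaches every block needed
      before time \<open>N\<close>.\<close>
    define k where "k = N + 1"
    define p where "p i = (if i = 1 then w else u (L * (q + i - 2)))" for i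
    define a where "a i = (if i = 1 then 0 else L * (q + i - 2) + M0)" for i
    define b where "b i = L * (q + i - 1) - 1" for i
    have step: "L * (q + i - 1) = L * (q + i - 2) + L" if "i \<ge> 2" for i
    proof -
      have "q + i - 1 = Suc (q + i - 2)" using that by simp
      then show ?thesis by simp
    qed
    have "\<exists>y\<in>M. \<forall>i\<in>{1..k}. \<forall>j\<in>{a i..b i}. d ((T ^^ j) y) ((T ^^ j) (p i)) \<le> e"
    proof (rule trace)
      show "\<forall>i\<in>{1..k}. p i \<in> M \<and> a i \<le> b i"
        using u(1) w L(1) step by (auto simp: p_def a_def b_def)
      show "\<forall>i\<in>{2..k}. b (i - 1) < a i \<and> b (i - 1) + M0 \<le> a i"
      proof
        fix i assume i: "i \<in> {2..k}"
        \<comment> \<open>\<open>b (i - 1)\<close> is one less than the start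
          \<open>L * (q + i - 2)\<close> of the next block, so the distance to \<open>a i\<close> is
          \<open>M0 + 1\<close>.\<close>
        have "L * (q + i - 2) > 0" using q i L(1) by simp
        then show "b (i - 1) < a i \<and> b (i - 1) + M0 \<le> a i"
          using i M0 by (auto simp: a_def b_def numeral_2_eq_2)
      qed
    qed (simp add: k_def)
    then obtain y where y: "y \<in> M"
      "\<And>i j. i \<in> {1..k} \<Longrightarrow> j \<in> {a i..b i} \<Longrightarrow> d ((T ^^ j) y) ((T ^^ j) (p i)) \<le> e"
      by blast
    have "d ((T ^^ j) y) ((T ^^ j) w) \<le> e" if "j < q * L" for j
      using y(2)[of 1 j] that by (simp add: a_def b_def p_def k_def mult.commute)
    moreover have "d ((T ^^ j) y) (x j) \<le> 2 * e" if j: "j \<in> {q * L..<N} - C" for j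
    proof -
      define i where "i = j div L + 2 - q"
      have "q \<le> j div L" using j L(1) by (simp add: less_eq_div_iff_mult_less_eq)
      then have i: "i \<ge> 2" "q + i - 2 = j div L" by (auto simp: i_def)
      have "j div L < N" using j by (auto intro: le_less_trans[OF div_le_dividend])
      then have "i \<in> {1..k}" using q i by (auto simp: k_def)
      moreover have jeq: "j = L * (j div L) + j mod L" by simp
      have "j mod L < L" using L(1) by simp
      have "L * (j div L) \<in> G" "M0 \<le> j mod L" using j by (auto simp: C_def)
      then have "L * (j div L) + M0 \<le> j" "j \<le> L * (j div L) + L - 1"
        using jeq \<open>j mod L < L\<close> by linarith+
      then have "j \<in> {a i..b i}"
        using i step[OF i(1)] by (auto simp: a_def b_def)
      ultimately have "d ((T ^^ j) y) ((T ^^ j) (u (L * (j div L)))) \<le> e"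
        using y(2)[of i j] i by (simp add: p_def)
      moreover have "d (x j) ((T ^^ j) (u (L * (j div L)))) < e"
        using u(2)[OF \<open>L * (j div L) \<in> G\<close> \<open>j mod L < L\<close>] by simp
      moreover have "d ((T ^^ j) y) (x j) \<le> d ((T ^^ j) y) ((T ^^ j) (u (L * (j div L))))
          + d (x j) ((T ^^ j) (u (L * (j div L))))"
        using TM u(1) y(1) xM by (intro triangle') auto
      ultimately show ?thesis by linarith
    qed
    ultimately show ?thesis using y(1) by blast
  qed
  with L(1) C_small show thesis by (intro that[of L C]) auto
qed

section \<open>Iterated extension and passage to the limit\<close>

lemma specification_imp_vague_specification:
  assumes compact: "compact_space mtopology" and T: "continuous_map mtopology mtopology T"
    and spec: "specification_property mtopology d T"
  shows "vague_specification_property mtopology d T"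
  unfolding vague_specification_property_def topspace_mtopology
proof (intro allI impI)
  fix x assume x: "vague_pseudo_orbit mtopology T x"
  have Tn: "continuous_map mtopology mtopology (T ^^ n)" for n
    by (rule continuous_map_funpow[OF T])
  have TM: "(T ^^ n) u \<in> M" if "u \<in> M" for n u
    using continuous_map_image_subset_topspace[OF Tn[of n]] that by auto
  have xM: "x n \<in> M" for n
    using x by (auto simp: vague_pseudo_orbit_def sequence_space_def PiE_iff)
  define \<epsilon> :: "nat \<Rightarrow> real" where "\<epsilon> k = (1/2) ^ k" for k
  have \<epsilon>_pos: "\<epsilon> k > 0" for k by (simp add: \<epsilon>_def)
  \<comment> \<open>One predicate for the whole outcome of an extension lets \<open>L k\<close> and
    \<open>C k\<close> be chosen for all \<open>k\<close> before any times or points.\<close>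
  define extends where "extends k L C \<longleftrightarrow> L > 0 \<and>
      (\<forall>\<^sub>F n in sequentially. real (card (C \<inter> {0..<n})) \<le> 3 * \<epsilon> k * real n) \<and>
      (\<forall>w q N. w \<in> M \<longrightarrow> q > 0 \<longrightarrow>
        (\<exists>y\<in>M. (\<forall>j<q * L. d ((T ^^ j) y) ((T ^^ j) w) \<le> \<epsilon> k) \<and>
          (\<forall>j\<in>{q * L..<N} - C. d ((T ^^ j) y) (x j) \<le> 2 * \<epsilon> k)))" for k L C
  have "\<exists>L C. extends k L C" for k
    by (rule specification_extend[OF compact T spec x \<epsilon>_pos[of k]]) (unfold extends_def, blast)
  then obtain L C where LC: "\<And>k. extends k (L k) (C k)" by metis
  have L: "L k > 0"
    and C: "\<forall>\<^sub>F n in sequentially. real (card (C k \<inter> {0..<n})) \<le> 3 * \<epsilon> k * real n" for k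
    using LC[of k] unfolding extends_def by blast+
  have extend: "\<exists>y\<in>M. (\<forall>j<q * L k. d ((T ^^ j) y) ((T ^^ j) w) \<le> \<epsilon> k) \<and>
      (\<forall>j\<in>{q * L k..<N} - C k. d ((T ^^ j) y) (x j) \<le> 2 * \<epsilon> k)"
    if "w \<in> M" "q > 0" for k w q N
    using LC[of k] that unfolding extends_def by blast
  \<comment> \<open>Divisibility and positivity write \<open>N k\<close> as \<open>q * L k\<close>
    with \<open>q > 0\<close>, an admissible end for the followed orbit; the last condition puts
    \<open>N k\<close> past the threshold of the density bound for \<open>C k\<close>.\<close>
  let ?P = "\<lambda>k N. N > 0 \<and> L k dvd N \<and>
    (\<forall>n\<ge>N. real (card (C k \<inter> {0..<n})) \<le> 3 * \<epsilon> k * real n)"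
  have large: "\<exists>N\<ge>m. ?P k N" for m k
  proof -
    obtain n0 where n0: "\<forall>n\<ge>n0. real (card (C k \<inter> {0..<n})) \<le> 3 * \<epsilon> k * real n"
      using C[of k] unfolding eventually_sequentially by blast
    have "m + n0 + 1 \<le> L k * (m + n0 + 1)" using L[of k] by (cases "L k") simp_all
    then show ?thesis using n0
      by (intro exI[of _ "L k * (m + n0 + 1)"]) (simp add: L)
  qed
  \<comment> \<open>The factor \<open>Suc k\<close> makes \<open>N k\<close> negligible against
    \<open>N (Suc k)\<close>, as \<open>patched_density_zero\<close> requires.\<close>
  have "\<exists>N. \<forall>k. ?P k (N k) \<and> N k < N (Suc k) \<and> Suc k * N k \<le> N (Suc k)"
  proof (rule dependent_nat_choice)
    show "\<exists>N. ?P 0 N" using large[of 0 0] by blast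
    show "\<exists>N'. ?P (Suc k) N' \<and> N < N' \<and> Suc k * N \<le> N'" for N k
      using large[of "Suc N + Suc k * N" "Suc k"] by (metis add_leE Suc_le_eq)
  qed
  then obtain N where N: "\<And>k. ?P k (N k)" and N_mono: "strict_mono N"
    and N_grow: "\<And>k. Suc k * N k \<le> N (Suc k)"
    unfolding strict_mono_Suc_iff by metis
  have "\<exists>z. \<forall>k. z k \<in> M \<and> (\<forall>j<N k. d ((T ^^ j) (z (Suc k))) ((T ^^ j) (z k)) \<le> \<epsilon> k) \<and>
      (\<forall>j\<in>{N k..<N (Suc k)} - C k. d ((T ^^ j) (z (Suc k))) (x j) \<le> 2 * \<epsilon> k)"
  proof (rule dependent_nat_choice)
    show "\<exists>z. z \<in> M" using xM by blast
    fix w k assume w: "w \<in> M"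
    obtain q where q: "N k = q * L k" using N[of k] by (metis dvd_div_mult_self)
    then have "q > 0" using N[of k] by (cases q) auto
    show "\<exists>y. y \<in> M \<and> (\<forall>j<N k. d ((T ^^ j) y) ((T ^^ j) w) \<le> \<epsilon> k) \<and>
      (\<forall>j\<in>{N k..<N (Suc k)} - C k. d ((T ^^ j) y) (x j) \<le> 2 * \<epsilon> k)"
      using extend[OF w \<open>q > 0\<close>, of k "N (Suc k)"] unfolding q by blast
  qed
  then obtain z where zM: "\<And>k. z k \<in> M"
    and z_close: "\<And>k j. j < N k \<Longrightarrow> d ((T ^^ j) (z (Suc k))) ((T ^^ j) (z k)) \<le> \<epsilon> k"
    and z_x: "\<And>k j. j \<in> {N k..<N (Suc k)} - C k \<Longrightarrow> d ((T ^^ j) (z (Suc k))) (x j) \<le> 2 * \<epsilon> k"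
    by metis
  \<comment> \<open>The right side is the exact value of the geometric sum of
    \<open>\<epsilon>\<close> from \<open>k\<close> to \<open>k + i - 1\<close>; in this form the
    telescoping induction closes.\<close>
  have z_far: "d ((T ^^ j) (z (k + i))) ((T ^^ j) (z k)) \<le> 2 * \<epsilon> k - 2 * \<epsilon> (k + i)" if "j < N k" for i j k
  proof (induction i)
    case (Suc i)
    have "j < N (k + i)"
      using that N_mono by (meson le_add1 order_less_le_trans strict_mono_less_eq)
    then have "d ((T ^^ j) (z (Suc (k + i)))) ((T ^^ j) (z (k + i))) \<le> \<epsilon> (k + i)"
      by (rule z_close)
    moreover have "d ((T ^^ j) (z (Suc (k + i)))) ((T ^^ j) (z k))
        \<le> d ((T ^^ j) (z (Suc (k + i)))) ((T ^^ j) (z (k + i))) + d ((T ^^ j) (z (k + i))) ((T ^^ j) (z k))"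
      using TM zM by (intro triangle) auto
    moreover have "\<epsilon> (k + i) = 2 * \<epsilon> (Suc (k + i))" by (simp add: \<epsilon>_def)
    ultimately show ?case using Suc by simp
  qed (use TM zM in simp)
  obtain l r where l: "l \<in> M" and r: "strict_mono (r :: nat \<Rightarrow> nat)"
    and lim: "limitin mtopology (z \<circ> r) l sequentially"
    using compact zM unfolding compact_space_sequentially by (metis image_subsetI)
  \<comment> \<open>The bound \<open>2 * \<epsilon> k\<close> holds along the subsequence once
    \<open>r n \<ge> k\<close>, and continuity of \<open>T ^^ j\<close> carries it to the limit up
    to an arbitrary \<open>e\<close>.\<close>
  have l_far: "d ((T ^^ j) l) ((T ^^ j) (z k)) \<le> 2 * \<epsilon> k" if j: "j < N k" for j k
  proof (rule field_le_epsilon)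
    fix e :: real assume "e > 0"
    have "limitin mtopology ((T ^^ j) \<circ> (z \<circ> r)) ((T ^^ j) l) sequentially"
      by (rule continuous_map_limit[OF Tn lim])
    then obtain n0 where n0: "\<And>n. n \<ge> n0 \<Longrightarrow> d ((T ^^ j) (z (r n))) ((T ^^ j) l) < e"
      unfolding limit_metric_sequentially using \<open>e > 0\<close> by (metis comp_apply)
    define n where "n = max n0 k"
    have "k \<le> r n"
      using strict_mono_imp_increasing[OF r, of n] by (simp add: n_def)
    then have "d ((T ^^ j) (z (r n))) ((T ^^ j) (z k)) \<le> 2 * \<epsilon> k"
      using z_far[OF j, of "r n - k"] \<epsilon>_pos[of "r n"] by simp
    moreover have "d ((T ^^ j) (z (r n))) ((T ^^ j) l) < e"
      by (rule n0) (simp add: n_def)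
    moreover have "d ((T ^^ j) l) ((T ^^ j) (z k))
        \<le> d ((T ^^ j) (z (r n))) ((T ^^ j) l) + d ((T ^^ j) (z (r n))) ((T ^^ j) (z k))"
      using TM zM l by (intro triangle'') auto
    ultimately show "d ((T ^^ j) l) ((T ^^ j) (z k)) \<le> 2 * \<epsilon> k + e" by linarith
  qed
  have l_x: "d ((T ^^ j) l) (x j) \<le> 3 * \<epsilon> k" if j: "j \<in> {N k..<N (Suc k)} - C k" for j k
  proof -
    \<comment> \<open>Comparison with \<open>z (Suc k)\<close> is valid for times up to
      \<open>N (Suc k)\<close> and costs
      \<open>2 * \<epsilon> (Suc k) = \<epsilon> k\<close>.\<close>
    have "d ((T ^^ j) l) ((T ^^ j) (z (Suc k))) \<le> \<epsilon> k"
      using l_far[of j "Suc k"] j by (simp add: \<epsilon>_def)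
    moreover have "d ((T ^^ j) l) (x j) \<le> d ((T ^^ j) l) ((T ^^ j) (z (Suc k))) + d ((T ^^ j) (z (Suc k))) (x j)"
      using TM zM l xM by (intro triangle) auto
    ultimately show ?thesis using z_x[OF j] by linarith
  qed
  \<comment> \<open>All lost times together; as the intervals are disjoint, \<open>B\<close> stays
    within \<open>C k\<close> on the \<open>k\<close>-th one.\<close>
  define B where "B = (\<Union>k. C k \<inter> {N k..<N (Suc k)})"
  have B_sub: "B \<inter> {N k..<N (Suc k)} \<subseteq> C k" for k
  proof
    fix n assume n: "n \<in> B \<inter> {N k..<N (Suc k)}"
    then obtain i where i: "n \<in> C i" "N i \<le> n" "n < N (Suc i)" by (auto simp: B_def)
    have "N i < N (Suc k)" "N k < N (Suc i)" using i n by auto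
    then have "i = k" using N_mono by (simp add: strict_mono_less)
    then show "n \<in> C k" using i by simp
  qed
  have "(\<lambda>k. 3 * \<epsilon> k) \<longlonglongrightarrow> 0"
    unfolding \<epsilon>_def by real_asymp
  then have B_zero: "\<forall>\<^sub>F n in sequentially. real (card (B \<inter> {0..<n})) \<le> e * real n" if "e > 0" for e
    using N_mono N_grow N B_sub that by (intro patched_density_zero[where C = C and N = N and \<delta> = "\<lambda>k. 3 * \<epsilon> k"]) auto
  have "density_one {n. d ((T ^^ n) l) (x n) < e}" if "e > 0" for e
    unfolding density_one_iff_complement
  proof (intro allI impI)
    fix e' :: real assume "e' > 0"
    have "\<forall>\<^sub>F k in sequentially. 3 * \<epsilon> k < e"
      by (rule order_tendstoD(2)[OF \<open>(\<lambda>k. 3 * \<epsilon> k) \<longlonglongrightarrow> 0\<close> \<open>e > 0\<close>])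
    then obtain K where K: "\<And>k. k \<ge> K \<Longrightarrow> 3 * \<epsilon> k < e"
      unfolding eventually_sequentially by blast
    \<comment> \<open>From \<open>N K\<close> on, a time outside \<open>B\<close> has error at most
      \<open>3 * \<epsilon> k < e\<close>, so failures lie in \<open>B\<close> or in a fixed finite
      initial segment.\<close>
    have sub: "{0..<n} - {n. d ((T ^^ n) l) (x n) < e} \<subseteq> {0..<N K} \<union> B \<inter> {0..<n}" for n
    proof
      fix j assume j: "j \<in> {0..<n} - {n. d ((T ^^ n) l) (x n) < e}"
      show "j \<in> {0..<N K} \<union> B \<inter> {0..<n}"
      proof (cases "j < N K")
        case False
        then have "N 0 \<le> j" using N_mono by (meson le0 leI order.trans strict_mono_less_eq)
        then obtain k where k: "N k \<le> j" "j < N (Suc k)"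
          using strict_mono_interval[OF N_mono] by blast
        then have "N K < N (Suc k)" using False by simp
        then have "K \<le> k" using N_mono by (simp add: strict_mono_less)
        then have "j \<in> C k" using K[of k] l_x[of j k] j k by force
        then show ?thesis using j k by (auto simp: B_def)
      qed simp
    qed
    have "\<forall>\<^sub>F n in sequentially. real (card (B \<inter> {0..<n})) \<le> e' / 2 * real n"
      by (rule B_zero) (use \<open>e' > 0\<close> in simp)
    moreover have "\<forall>\<^sub>F n in sequentially. real (N K) \<le> e' / 2 * real n"
      using \<open>e' > 0\<close> by real_asymp
    ultimately show "\<forall>\<^sub>F n in sequentially.
        real (card ({0..<n} - {n. d ((T ^^ n) l) (x n) < e})) \<le> e' * real n"
    proof eventually_elim
      case (elim n)
      have "card ({0..<n} - {n. d ((T ^^ n) l) (x n) < e}) \<le> card ({0..<N K} \<union> B \<inter> {0..<n})"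
        using sub by (intro card_mono) auto
      also have "\<dots> \<le> N K + card (B \<inter> {0..<n})"
        using card_Un_le[of "{0..<N K}"] by simp
      finally show ?case using elim by linarith
    qed
  qed
  then show "\<exists>z\<in>M. \<forall>\<epsilon>>0. density_one {n. d ((T ^^ n) z) (x n) < \<epsilon>}"
    using l by blast
qed

end

section \<open>From metric spaces to topological dynamical systems\<close>

theorem corollary7p1:
  fixes X :: "'a topology" and \<rho> :: "'a \<Rightarrow> 'a \<Rightarrow> real" and T :: "'a \<Rightarrow> 'a"
  assumes "topological_dynamical_system X T"
    and "compatible_metric X \<rho>"
    and "specification_property X \<rho> T"
  shows "vague_specification_property X \<rho> T"
proof -
  have "Metric_space (topspace X) \<rho>" and X: "Metric_space.mtopology (topspace X) \<rho> = X"
    using assms(2) by (auto simp: compatible_metric_def)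
  then interpret Metric_space "topspace X" \<rho> by blast
  show ?thesis
    using specification_imp_vague_specification[of T] assms(1,3)
    unfolding X topological_dynamical_system_def by blast
qed

end
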